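(* Let $m_1,m_2$ be positive real numbers with $m_1\leq 1.8m_2$, and let $\beta$ be the real root in the interval $[0.5,1)$ of the polynomial $2m_2(1-x)(1+x)^2-m_1x(2+x)$. Let $G\in \mathcal{G}_{m_1,m_2}$. If \[\Delta(G)\geq \frac{2}{1-\beta}m_1,\] then $G$ has an equitable $r$-coloring for every integer $r\geq \Delta(G)$.
   Context: All graphs are finite and simple. For a graph $H$, $|H|$ denotes its number of vertices and $\lVert H\rVert$ its number of edges; $\Delta(G)$ is the maximum degree of $G$. For real numbers $m_1,m_2$, $\mathcal{G}_{m_1,m_2}$ is the class of graphs $G$ such that $\lVert H\rVert\leq m_1|H|$ for every subgraph $H$ of $G$, and $\lVert H\rVert\leq m_2|H|$ for every bipartite subgraph $H$ of $G$. An equitable $r$-coloring of a graph is a partition of its vertex set into $r$ independent sets $V_1,\dots,V_r$ (some possibly empty) with $\big||V_i|-|V_j|\big|\leq 1$ for all $i,j$. When $m_1\le 1.8m_2$, the function $\frac{2(1-x)(1+x)^2}{x(x+2)}$ is decreasing on $[0.5,1)$ from $1.8$ to $0$, so the root $\beta\in[0.5,1)$ exists and is unique. *)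

theory Defs
  imports Complex_Main
begin

definition simple_graph :: "'a set \<Rightarrow> 'a set set \<Rightarrow> bool" where
  "simple_graph V E \<longleftrightarrow> finite V \<and> (\<forall>e\<in>E. e \<subseteq> V \<and> card e = 2)"

definition subgraph :: "'a set \<Rightarrow> 'a set set \<Rightarrow> 'a set \<Rightarrow> 'a set set \<Rightarrow> bool" where
  "subgraph W F V E \<longleftrightarrow> W \<subseteq> V \<and> F \<subseteq> E \<and> (\<forall>e\<in>F. e \<subseteq> W)"

definition bipartite :: "'a set \<Rightarrow> 'a set set \<Rightarrow> bool" where
  "bipartite W F \<longleftrightarrow> (\<exists>A. A \<subseteq> W \<and> (\<forall>e\<in>F. card (e \<inter> A) = 1))"

definition graph_class :: "real \<Rightarrow> real \<Rightarrow> 'a set \<Rightarrow> 'a set set \<Rightarrow> bool" where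
  "graph_class m1 m2 V E \<longleftrightarrow>
     simple_graph V E \<and>
     (\<forall>W F. subgraph W F V E \<longrightarrow> real (card F) \<le> m1 * real (card W)) \<and>
     (\<forall>W F. subgraph W F V E \<and> bipartite W F \<longrightarrow> real (card F) \<le> m2 * real (card W))"

definition degree :: "'a set set \<Rightarrow> 'a \<Rightarrow> nat" where
  "degree E v = card {e\<in>E. v \<in> e}"

definition max_degree :: "'a set \<Rightarrow> 'a set set \<Rightarrow> nat" where
  "max_degree V E = Max (insert 0 (degree E ` V))"

definition equitable_coloring :: "'a set \<Rightarrow> 'a set set \<Rightarrow> nat \<Rightarrow> bool" where
  "equitable_coloring V E r \<longleftrightarrow>
     (\<exists>c :: 'a \<Rightarrow> nat.
        (\<forall>v\<in>V. c v < r) \<and>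
        (\<forall>e\<in>E. \<forall>u\<in>e. \<forall>v\<in>e. u \<noteq> v \<longrightarrow> c u \<noteq> c v) \<and>
        (\<forall>i<r. \<forall>j<r. card {v\<in>V. c v = i} \<le> card {v\<in>V. c v = j} + 1))"

end

theory Submission
  imports Defs
begin

text \<open>
  Induct on the number of vertices, deleting a vertex \<open>x\<close> of degree at most \<open>2 m\<^sub>1\<close>; put
  \<open>\<alpha> = \<beta> / (2 (1 + \<beta>))\<close>, so that \<open>m\<^sub>2 \<le> \<alpha> (1 - \<alpha>) r\<close> and \<open>2 m\<^sub>1 \<le> (1 - 3 \<alpha>) r\<close>.
  Consider equitable colorings of \<open>G - z\<close> for a single uncolored vertex \<open>z\<close>, the token, all
  classes having size \<open>s\<close> or \<open>s - 1\<close>. A class is accessible if shifting vertices along a chain of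
  classes leads from it to a class of size \<open>s - 1\<close>; if the token fits into an accessible class, the
  coloring can be completed. Among the states whose token fits into at least \<open>\<alpha> r\<close> classes take
  one with the most accessible classes. The token can be exchanged with every vertex of a family
  \<open>R\<close> of classes, and all possible tokens have neighbours in all classes outside \<open>R\<close>, so the
  bound on bipartite subgraphs forces \<open>|R| > (1 - \<alpha>) r\<close>.

  In an accessible class at maximal distance from the small ones, double counting gives a vertex
  \<open>w\<close> which is the only neighbour in its class of at least \<open>|R|\<close> possible tokens; let \<open>S\<close> be the set of
  these. Since \<open>|S| > 2 m\<^sub>1\<close>, some \<open>y\<close> in \<open>S\<close> has degree at most \<open>2 m\<^sub>1\<close> in \<open>S + w\<close>. Make \<open>y\<close> the token
  and let it replace \<open>w\<close>: then a vertex of \<open>S\<close> not adjacent to \<open>y\<close> makes one more class accessible, so by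
  maximality the new token \<open>w\<close> fits into fewer than \<open>\<alpha> r\<close> classes. Hence more than
  \<open>(1 - 3 \<alpha>) r - 1\<close> vertices \<open>u\<close> of \<open>S\<close> are the only neighbour of \<open>w\<close> in their class. Such a \<open>u\<close>
  must be adjacent to \<open>y\<close>, as otherwise \<open>w\<close> could replace \<open>u\<close>, and \<open>u\<close> could join \<open>y\<close> in the
  former class of \<open>w\<close>. This contradicts the choice of \<open>y\<close>.
\<close>

section \<open>Equitable colorings by adjacency, and images of finite sets\<close>

definition has_equitable :: "'a set \<Rightarrow> ('a \<Rightarrow> 'a \<Rightarrow> bool) \<Rightarrow> nat \<Rightarrow> bool" where
  "has_equitable V adj r \<longleftrightarrow>
     (\<exists>c. (\<forall>v\<in>V. c v < r) \<and> (\<forall>u\<in>V. \<forall>v\<in>V. adj u v \<longrightarrow> c u \<noteq> c v) \<and>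
          (\<forall>i<r. \<forall>j<r. card {v\<in>V. c v = i} \<le> card {v\<in>V. c v = j} + 1))"

lemma has_equitableI:
  assumes "\<And>v. v \<in> V \<Longrightarrow> c v < r"
    and "\<And>u v. u \<in> V \<Longrightarrow> v \<in> V \<Longrightarrow> adj u v \<Longrightarrow> c u \<noteq> c v"
    and "\<And>i. i < r \<Longrightarrow> card {v\<in>V. c v = i} = s \<or> Suc (card {v\<in>V. c v = i}) = s"
  shows "has_equitable V adj r"
  unfolding has_equitable_def
proof (intro exI[of _ c] conjI ballI allI impI)
  fix i j assume "i < r" "j < r"
  then show "card {v\<in>V. c v = i} \<le> card {v\<in>V. c v = j} + 1"
    using assms(3)[of i] assms(3)[of j] by linarith
qed (use assms in auto)

text \<open>Every value of \<open>g\<close> counts 2 on the left. A fibre with at least two elements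
  pays for it in \<open>card X\<close>; the element of a singleton fibre is counted in both terms on
  the right.\<close>

lemma twice_card_image_le:
  assumes "finite X"
  shows "2 * card (g ` X) \<le> card X + card {u\<in>X. \<forall>u'\<in>X. g u' = g u \<longrightarrow> u' = u}"
proof -
  define U where "U = {u\<in>X. \<forall>u'\<in>X. g u' = g u \<longrightarrow> u' = u}"
  let ?Y = "X - U"
  have fin: "finite ?Y" "finite U" using assms by (auto simp: U_def)
  have fibre: "2 \<le> card {x\<in>?Y. g x = k}" if k: "k \<in> g ` ?Y" for k
  proof -
    from k obtain u where u: "u \<in> X" "u \<notin> U" "k = g u" by auto
    then obtain u' where u': "u' \<in> X" "g u' = g u" "u' \<noteq> u" by (auto simp: U_def)
    then have "u' \<notin> U" using u by (auto simp: U_def)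
    then have "{u, u'} \<subseteq> {x\<in>?Y. g x = k}" using u u' by auto
    then have "card {u, u'} \<le> card {x\<in>?Y. g x = k}" by (intro card_mono) (use fin in auto)
    then show ?thesis using u'(3) by auto
  qed
  have "2 * card (g ` ?Y) = (\<Sum>k\<in>g ` ?Y. 2)" by simp
  also have "\<dots> \<le> (\<Sum>k\<in>g ` ?Y. card {x\<in>?Y. g x = k})" by (intro sum_mono fibre)
  also have "\<dots> = card ?Y"
    using sum.image_gen[OF fin(1), of "\<lambda>_. 1::nat" g] by simp
  finally have 1: "2 * card (g ` ?Y) \<le> card ?Y" .
  have "g ` X = g ` U \<union> g ` ?Y" by (auto simp: U_def)
  then have "card (g ` X) \<le> card (g ` U) + card (g ` ?Y)" by (metis card_Un_le)
  moreover have "card (g ` U) \<le> card U" using fin by (simp add: card_image_le)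
  moreover have "card X = card U + card ?Y"
    using card_Diff_subset[OF fin(2), of X] card_mono[OF assms, of U] by (auto simp: U_def)
  ultimately show ?thesis using 1 unfolding U_def[symmetric] by linarith
qed

text \<open>
  A pair of a coloring \<open>c\<close> and a token \<open>z\<close> represents a coloring of \<open>V - {z}\<close>; the value \<open>c z\<close> is
  irrelevant.
\<close>

locale token_coloring =
  fixes V :: "'a set" and adj :: "'a \<Rightarrow> 'a \<Rightarrow> bool" and r s :: nat
  assumes finite_V: "finite V"
    and adj_sym: "adj u v \<Longrightarrow> adj v u"
    and adj_irrefl: "\<not> adj u u"
begin

section \<open>Token colorings, accessible classes and token moves\<close>

definition cls :: "('a \<Rightarrow> nat) \<Rightarrow> 'a \<Rightarrow> nat \<Rightarrow> 'a set" where
  "cls c z i = {v\<in>V. v \<noteq> z \<and> c v = i}"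

definition free :: "('a \<Rightarrow> nat) \<Rightarrow> 'a \<Rightarrow> 'a \<Rightarrow> nat \<Rightarrow> bool" where
  "free c z u j \<longleftrightarrow> j < r \<and> (\<forall>x\<in>cls c z j. \<not> adj u x)"

definition state :: "('a \<Rightarrow> nat) \<Rightarrow> 'a \<Rightarrow> bool" where
  "state c z \<longleftrightarrow> z \<in> V \<and> (\<forall>v\<in>V - {z}. c v < r) \<and>
     (\<forall>u\<in>V - {z}. \<forall>v\<in>V - {z}. adj u v \<longrightarrow> c u \<noteq> c v) \<and>
     (\<forall>i<r. card (cls c z i) = s \<or> Suc (card (cls c z i)) = s) \<and>
     (\<exists>i<r. Suc (card (cls c z i)) = s)"

text \<open>The length \<open>n\<close> of the chain of shifts is kept as an argument since shortest
  chains matter below: they do not return to the class they start from.\<close>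

primrec acc :: "('a \<Rightarrow> nat) \<Rightarrow> 'a \<Rightarrow> nat \<Rightarrow> nat \<Rightarrow> bool" where
  "acc c z 0 i \<longleftrightarrow> i < r \<and> Suc (card (cls c z i)) = s"
| "acc c z (Suc n) i \<longleftrightarrow> i < r \<and> (\<exists>u\<in>cls c z i. \<exists>j. acc c z n j \<and> free c z u j)"

definition Acc :: "('a \<Rightarrow> nat) \<Rightarrow> 'a \<Rightarrow> nat set" where
  "Acc c z = {i. \<exists>n. acc c z n i}"

definition move :: "('a \<Rightarrow> nat) \<times> 'a \<Rightarrow> ('a \<Rightarrow> nat) \<times> 'a \<Rightarrow> bool" where
  "move p q \<longleftrightarrow> (case p of (c, z) \<Rightarrow> case q of (c', z') \<Rightarrow>
     (\<exists>j. free c z z j \<and> z' \<in> cls c z j \<and> c' = c(z := j)))"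

lemma finite_cls [simp]: "finite (cls c z i)"
  using finite_V by (simp add: cls_def)

lemma cls_disjoint: "i \<noteq> j \<Longrightarrow> cls c z i \<inter> cls c z j = {}"
  by (auto simp: cls_def)

lemma acc_less: "acc c z n i \<Longrightarrow> i < r"
  by (cases n) auto

lemma Acc_subset: "Acc c z \<subseteq> {..<r}"
  by (auto simp: Acc_def dest: acc_less)

lemma finite_Acc [simp]: "finite (Acc c z)"
  using Acc_subset finite_subset by blast

lemma AccI: "acc c z n i \<Longrightarrow> i \<in> Acc c z"
  by (auto simp: Acc_def)

lemma Acc_step:
  assumes "u \<in> cls c z i" "i < r" "free c z u j" "j \<in> Acc c z"
  shows "i \<in> Acc c z"
proof -
  obtain n where "acc c z n j" using assms(4) by (auto simp: Acc_def)
  then have "acc c z (Suc n) i" using assms by auto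
  then show ?thesis by (rule AccI)
qed

lemma cls_replace:
  assumes "z \<in> V" "z' \<in> cls c z j"
  shows "cls (c(z := j)) z' i = (if i = j then insert z (cls c z j - {z'}) else cls c z i)"
  using assms by (auto simp: cls_def)

lemma proper_update:
  assumes "\<And>u v. u \<in> V - {z} \<Longrightarrow> v \<in> V - {z} \<Longrightarrow> adj u v \<Longrightarrow> c u \<noteq> c v"
    and new: "\<And>x. x \<in> X \<Longrightarrow> x \<noteq> z \<Longrightarrow> adj z x \<Longrightarrow> c x \<noteq> j"
    and "X \<subseteq> V" "u \<in> X" "v \<in> X" "adj u v"
  shows "(c(z := j)) u \<noteq> (c(z := j)) v"
proof (cases "u = z")
  case True
  then have "v \<noteq> z" using assms(6) adj_irrefl by blast
  then show ?thesis using new[of v] assms True by auto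
next
  case uz: False
  show ?thesis
  proof (cases "v = z")
    case True
    then show ?thesis using uz new[of u] assms adj_sym by auto
  next
    case False
    then show ?thesis using uz assms(1)[of u v] assms(3-6) by auto
  qed
qed

text \<open>The only vertex of the class that can conflict with \<open>z\<close> is the one that
  leaves. This covers both moves of a token into a free class and exchanges of a token with its only
  neighbour in a class.\<close>

lemma state_replace:
  assumes st: "state c z" and z': "z' \<in> cls c z j"
    and nb: "\<And>u. u \<in> cls c z j \<Longrightarrow> adj z u \<Longrightarrow> u = z'"
  shows "state (c(z := j)) z'"
proof -
  have zV: "z \<in> V" using st by (simp add: state_def)
  have j: "j < r" "z' \<in> V" "z' \<noteq> z" "c z' = j" using st z' by (auto simp: state_def cls_def)
  have "z \<notin> cls c z j" by (simp add: cls_def)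
  then have "card (insert z (cls c z j - {z'})) = card (cls c z j)"
    using z' card_Suc_Diff1[of "cls c z j" z'] by simp
  then have sz: "card (cls (c(z := j)) z' i) = card (cls c z i)" for i
    by (simp add: cls_replace[OF zV z'])
  have proper: "(c(z := j)) u \<noteq> (c(z := j)) v"
    if "u \<in> V - {z'}" "v \<in> V - {z'}" "adj u v" for u v
  proof (rule proper_update[OF _ _ _ that])
    show "c x \<noteq> j" if "x \<in> V - {z'}" "x \<noteq> z" "adj z x" for x
      using nb[of x] that by (auto simp: cls_def)
  qed (use st in \<open>auto simp: state_def\<close>)
  have "(c(z := j)) v < r" if "v \<in> V - {z'}" for v
    using st j(1) that by (simp add: state_def)
  then show ?thesis
    unfolding state_def sz using st j(2) proper unfolding state_def by blast
qed

text \<open>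
  The class \<open>v\<close> may change: it is not used by chains of length \<open>n\<close> as it is not accessible in fewer steps.
\<close>

lemma acc_mono:
  assumes same: "\<And>k. k \<noteq> v \<Longrightarrow> k \<in> Acc c z \<Longrightarrow> cls c' z' k = cls c z k"
  shows "acc c z n i \<Longrightarrow> i \<noteq> v \<Longrightarrow> (\<And>m. m < n \<Longrightarrow> \<not> acc c z m v) \<Longrightarrow> acc c' z' n i"
proof (induction n arbitrary: i)
  case 0
  then show ?case using same[of i] AccI[of c z 0 i] by auto
next
  case (Suc n)
  then obtain u j where u: "i < r" "u \<in> cls c z i" "acc c z n j" "free c z u j" by auto
  then have jv: "j \<noteq> v" using Suc.prems(3)[of n] by auto
  have "acc c' z' n j" using Suc.IH[OF u(3) jv] Suc.prems(3) by auto
  moreover have "cls c' z' j = cls c z j" using same jv AccI u(3) by blast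
  moreover have "cls c' z' i = cls c z i" using same Suc.prems AccI by blast
  moreover have "free c' z' u j" using u(4) calculation(2) by (simp add: free_def)
  ultimately show ?case using u(1,2) by auto
qed

text \<open>Put the token into class \<open>i\<close> and make the vertex \<open>u\<close> that can
  be shifted out of it the new token: the remaining chain is one step shorter. Taking the chain
  shortest keeps \<open>i\<close> out of the rest of it. A chain of length 0 means that the token
  fills a small class.\<close>

lemma equitable_if_free_acc:
  "state c z \<Longrightarrow> free c z z i \<Longrightarrow> acc c z n i \<Longrightarrow> has_equitable V adj r"
proof (induction n arbitrary: c z i rule: less_induct)
  case (less n)
  note st = less.prems(1)
  have zV: "z \<in> V" using st by (simp add: state_def)
  show ?case
  proof (cases "\<exists>m<n. acc c z m i")
    case True
    then show ?thesis using less by blast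
  next
    case False
    show ?thesis
    proof (cases n)
      case 0
      let ?d = "c(z := i)"
      have i: "i < r" "Suc (card (cls c z i)) = s" using less.prems 0 by auto
      have cl: "{v\<in>V. ?d v = k} = (if k = i then insert z (cls c z i) else cls c z k)" for k
        using zV by (auto simp: cls_def)
      have ins: "card (insert z (cls c z i)) = s" using i by (simp add: cls_def finite_V)
      have proper: "?d u \<noteq> ?d v" if "u \<in> V" "v \<in> V" "adj u v" for u v
      proof (rule proper_update[OF _ _ _ that])
        show "c x \<noteq> i" if "x \<in> V" "x \<noteq> z" "adj z x" for x
          using less.prems(2) that by (auto simp: cls_def free_def)
      qed (use st in \<open>auto simp: state_def\<close>)
      show ?thesis
      proof (rule has_equitableI[of V ?d r adj s])
        show "?d v < r" if "v \<in> V" for v using that st i by (simp add: state_def)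
        show "card {v\<in>V. ?d v = k} = s \<or> Suc (card {v\<in>V. ?d v = k}) = s" if "k < r" for k
          unfolding cl using that st ins by (simp add: state_def)
      qed (use proper in blast)
    next
      case (Suc m)
      then obtain u j where u: "u \<in> cls c z i" "acc c z m j" "free c z u j"
        using less.prems by auto
      let ?d = "c(z := i)"
      have ji: "j \<noteq> i" using False u Suc by auto
      have st': "state ?d u"
        by (rule state_replace[OF st u(1)]) (use less.prems(2) in \<open>auto simp: free_def\<close>)
      have eq: "cls ?d u k = cls c z k" if "k \<noteq> i" for k
        using that by (simp add: cls_replace[OF zV u(1)])
      have "acc ?d u m j"
        by (rule acc_mono[where v = i and c = c and z = z]) (use eq u ji False Suc in auto)
      moreover have "free ?d u u j" using u(3) eq[OF ji] by (simp add: free_def)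
      ultimately show ?thesis using less.IH[of m] st' Suc by blast
    qed
  qed
qed

lemma equitable_if_free_Acc:
  "state c z \<Longrightarrow> free c z z i \<Longrightarrow> i \<in> Acc c z \<Longrightarrow> has_equitable V adj r"
  using equitable_if_free_acc by (auto simp: Acc_def)

lemma small_in_Acc: "i < r \<Longrightarrow> Suc (card (cls c z i)) = s \<Longrightarrow> i \<in> Acc c z"
  by (rule AccI[of _ _ 0]) simp

lemma Acc_nonempty: "state c z \<Longrightarrow> Acc c z \<noteq> {}"
  unfolding state_def using small_in_Acc by blast

text \<open>The place missing in some small class makes up for the token.\<close>

lemma card_V_le:
  assumes "state c z"
  shows "card V \<le> r * s"
proof -
  have V: "V = insert z (\<Union>i<r. cls c z i)" using assms by (auto simp: state_def cls_def)
  obtain i where i: "i < r" "Suc (card (cls c z i)) = s" using assms by (auto simp: state_def)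
  have "card (\<Union>i<r. cls c z i) \<le> (\<Sum>i<r. card (cls c z i))" by (rule card_UN_le) simp
  also have "\<dots> < (\<Sum>i<r. s)"
  proof (rule sum_strict_mono_ex1)
    show "\<forall>x\<in>{..<r}. card (cls c z x) \<le> s"
    proof
      fix x assume "x \<in> {..<r}"
      then have "card (cls c z x) = s \<or> Suc (card (cls c z x)) = s"
        using assms unfolding state_def by blast
      then show "card (cls c z x) \<le> s" by linarith
    qed
    show "\<exists>a\<in>{..<r}. card (cls c z a) < s" using i by (intro bexI[of _ i]) auto
  qed simp
  finally have "card (\<Union>i<r. cls c z i) < r * s" by simp
  then show ?thesis by (subst V) (simp add: card_insert_if)
qed

section \<open>Reachable tokens and the classes they fit into\<close>

definition reach :: "('a \<Rightarrow> nat) \<Rightarrow> 'a \<Rightarrow> ('a \<Rightarrow> nat) \<Rightarrow> 'a \<Rightarrow> bool" where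
  "reach c z c' y \<longleftrightarrow> move\<^sup>*\<^sup>* (c, z) (c', y)"

definition Rch :: "('a \<Rightarrow> nat) \<Rightarrow> 'a \<Rightarrow> nat set" where
  "Rch c z = {j. \<exists>c' y. reach c z c' y \<and> free c' y y j}"

definition Tok :: "('a \<Rightarrow> nat) \<Rightarrow> 'a \<Rightarrow> 'a set" where
  "Tok c z = {y. \<exists>c'. reach c z c' y}"

lemma reach_refl: "reach c z c z"
  by (simp add: reach_def)

lemma reach_step:
  assumes "reach c z c' y" "free c' y y j" "y' \<in> cls c' y j"
  shows "reach c z (c'(y := j)) y'"
proof -
  have "move (c', y) (c'(y := j), y')" using assms by (auto simp: move_def)
  then show ?thesis using assms(1) by (auto simp: reach_def intro: rtranclp.rtrancl_into_rtrancl)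
qed

lemma reach_induct [consumes 1, case_names refl step]:
  assumes "reach c z c' y"
    and "P c z"
    and "\<And>d u j u'. reach c z d u \<Longrightarrow> P d u \<Longrightarrow> free d u u j \<Longrightarrow> u' \<in> cls d u j \<Longrightarrow> P (d(u := j)) u'"
  shows "P c' y"
proof -
  have "move\<^sup>*\<^sup>* (c, z) p \<Longrightarrow> P (fst p) (snd p)" for p
  proof (induction rule: rtranclp_induct)
    case base
    then show ?case using assms(2) by simp
  next
    case (step p q)
    obtain d u where p: "p = (d, u)" by force
    obtain j u' where q: "q = (d(u := j), u')" "free d u u j" "u' \<in> cls d u j"
      using step(2) p by (auto simp: move_def)
    show ?case using assms(3)[of d u j u'] step p q by (simp add: reach_def del: fun_upd_apply)
  qed
  from this[of "(c', y)"] show ?thesis using assms(1) by (simp add: reach_def)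
qed

lemma reach_state: "reach c z c' y \<Longrightarrow> state c z \<Longrightarrow> state c' y"
  by (induction rule: reach_induct) (auto intro!: state_replace simp: free_def)

text \<open>A move changes only the class that the token enters, and this class lies in
  \<open>Rch c z\<close>.\<close>

lemma reach_cls_outside:
  assumes "reach c z c' y" "state c z" "k \<notin> Rch c z"
  shows "cls c' y k = cls c z k"
  using assms
proof (induction rule: reach_induct)
  case (step d u j u')
  then have "j \<in> Rch c z" by (auto simp: Rch_def)
  then have "k \<noteq> j" using step by auto
  moreover have "u \<in> V" using reach_state[OF step(1)] step by (simp add: state_def)
  ultimately show ?case using step by (simp add: cls_replace del: fun_upd_apply)
qed simp

lemma Rch_subset: "Rch c z \<subseteq> {..<r}"
  by (auto simp: Rch_def free_def)

lemma free_subset_Rch: "{j. free c z z j} \<subseteq> Rch c z"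
  using reach_refl by (auto simp: Rch_def)

text \<open>Moves eject vertices only from classes in \<open>Rch c z\<close>. Conversely, when some
  token fits into class \<open>j\<close>, a vertex that was in \<open>j\<close> at the start is
  still there and can be ejected, or is the token itself, or has been recolored on the way.\<close>

lemma Tok_eq:
  assumes st: "state c z"
  shows "Tok c z = insert z (\<Union>j\<in>Rch c z. cls c z j)"
proof (intro equalityI subsetI)
  fix y assume "y \<in> Tok c z"
  then obtain c' where "reach c z c' y" by (auto simp: Tok_def)
  then show "y \<in> insert z (\<Union>j\<in>Rch c z. cls c z j)"
  proof (induction rule: reach_induct)
    case (step d u j u')
    have j: "j \<in> Rch c z" using step by (auto simp: Rch_def)
    show ?case
    proof (cases "u' = z \<or> c u' \<in> Rch c z")
      case True
      then show ?thesis using step.hyps(3) by (auto simp: cls_def)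
    next
      case False
      then have "u' \<in> cls c z (c u')" using step.hyps(3) by (auto simp: cls_def)
      then have "u' \<in> cls d u (c u')" using reach_cls_outside[OF step.hyps(1) st] False by auto
      then show ?thesis using step.hyps(3) j False by (auto simp: cls_def)
    qed
  qed simp
next
  fix y assume "y \<in> insert z (\<Union>j\<in>Rch c z. cls c z j)"
  then consider "y = z" | j where "j \<in> Rch c z" "y \<in> cls c z j" by auto
  then show "y \<in> Tok c z"
  proof cases
    case 1
    then show ?thesis using reach_refl by (auto simp: Tok_def)
  next
    case 2
    then obtain d u where d: "reach c z d u" "free d u u j" by (auto simp: Rch_def)
    \<comment> \<open>Only a token is ever recolored.\<close>
    have moved: "d v \<noteq> c v \<Longrightarrow> v \<in> Tok c z" for v
      using d(1) by (induction rule: reach_induct) (auto simp: Tok_def split: if_splits)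
    show ?thesis
    proof (cases "y = u \<or> d y \<noteq> c y")
      case True
      then show ?thesis using moved d(1) by (auto simp: Tok_def)
    next
      case False
      then have "y \<in> cls d u j" using 2 by (auto simp: cls_def)
      then show ?thesis using reach_step[OF d] by (auto simp: Tok_def)
    qed
  qed
qed

lemma Tok_dominated:
  assumes "state c z" "u \<in> Tok c z" "i < r" "i \<notin> Rch c z"
  shows "\<exists>x\<in>cls c z i. adj u x"
proof -
  obtain c' where c': "reach c z c' u" using assms by (auto simp: Tok_def)
  then have "\<not> free c' u u i" using assms by (auto simp: Rch_def)
  then show ?thesis using reach_cls_outside[OF c'] assms by (auto simp: free_def)
qed

text \<open>Moves only rearrange the possible tokens within the classes of \<open>Rch c z\<close>,
  as all other classes keep their members.\<close>

lemma Tok_color: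
  assumes "state c z" "reach c z c' y" "u \<in> Tok c z" "u \<noteq> y"
  shows "c' u \<in> Rch c z" "u \<in> cls c' y (c' u)"
proof -
  have uV: "u \<in> V" using assms(1,3) by (auto simp: Tok_eq state_def cls_def)
  then show *: "u \<in> cls c' y (c' u)" using assms by (auto simp: cls_def)
  show "c' u \<in> Rch c z"
  proof (rule ccontr)
    assume n: "c' u \<notin> Rch c z"
    then have "u \<in> cls c z (c' u)" using * reach_cls_outside[OF assms(2,1) n] by simp
    then show False using n assms(3) by (auto simp: Tok_eq[OF assms(1)] cls_def)
  qed
qed

lemma Acc_mono_same:
  assumes "\<And>k. k \<in> Acc c z \<Longrightarrow> cls c' z' k = cls c z k"
  shows "Acc c z \<subseteq> Acc c' z'"
proof
  fix i assume i: "i \<in> Acc c z"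
  then obtain n where n: "acc c z n i" by (auto simp: Acc_def)
  \<comment> \<open>No class has index \<open>r\<close>, so \<open>acc_mono\<close> with
    \<open>v = r\<close> exempts no class.\<close>
  have ir: "i \<noteq> r" "\<not> acc c z m r" for m using n acc_less[of c z _ r] acc_less[of c z n i] by auto
  show "i \<in> Acc c' z'"
    by (rule AccI, rule acc_mono[where v = r and c = c and z = z, OF _ n]) (use assms ir in auto)
qed

text \<open>A reachable token that fits into an accessible class would complete the coloring. To
  apply this after several moves, the accessible classes must still be intact; \<open>inv\<close>
  shows this along the moves, using \<open>noacc\<close> at each of them.\<close>

lemma Rch_Acc_disjoint:
  assumes st: "state c z" and ne: "\<not> has_equitable V adj r"
  shows "Rch c z \<inter> Acc c z = {}"
proof -
  have noacc: "j \<notin> Acc c z"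
    if "reach c z d u" "free d u u j" "\<And>k. k \<in> Acc c z \<Longrightarrow> cls d u k = cls c z k" for d u j
  proof
    assume "j \<in> Acc c z"
    then have "j \<in> Acc d u" using Acc_mono_same[of c z d u] that(3) by blast
    then show False using equitable_if_free_Acc[OF reach_state[OF that(1) st] that(2)] ne by blast
  qed
  have inv: "\<forall>k\<in>Acc c z. cls d u k = cls c z k" if "reach c z d u" for d u
    using that
  proof (induction rule: reach_induct)
    case (step d u j u')
    have "j \<notin> Acc c z" using noacc step by blast
    moreover have "u \<in> V" using reach_state[OF step(1) st] by (simp add: state_def)
    ultimately show ?case using step by (auto simp: cls_replace simp del: fun_upd_apply)
  qed simp
  show ?thesis using noacc inv by (auto simp: Rch_def)
qed

lemma cls_subset_Tok:
  assumes "state c z" "reach c z c' y" "x \<in> cls c' y j" "j \<in> Rch c z"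
  shows "x \<in> Tok c z"
proof (rule ccontr)
  assume x: "x \<notin> Tok c z"
  then have n: "x \<in> cls c z (c x)" "c x \<notin> Rch c z"
    using assms by (auto simp: Tok_eq[OF assms(1)] cls_def)
  then have "x \<in> cls c' y (c x)" using reach_cls_outside[OF assms(2,1) n(2)] by simp
  then show False using assms(3,4) n(2) by (auto simp: cls_def)
qed

lemma Tok_subset: "state c z \<Longrightarrow> Tok c z \<subseteq> V"
  by (auto simp: Tok_eq state_def cls_def)

section \<open>Counting in classes, a most distant accessible class, solo neighbours\<close>

lemma card_Union_cls:
  assumes "finite I" "\<And>i. i \<in> I \<Longrightarrow> card (cls c z i) = k"
  shows "card (\<Union>i\<in>I. cls c z i) = card I * k"
  using card_UN_disjoint[of I "cls c z"] assms cls_disjoint by simp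

lemma card_cls_not_Acc:
  assumes "state c z" "i < r" "i \<notin> Acc c z"
  shows "card (cls c z i) = s"
  using assms small_in_Acc[of i c z] by (auto simp: state_def)

lemma card_le_neighbours:
  assumes "finite X" "\<And>i. i \<in> I \<Longrightarrow> \<exists>x\<in>X. adj u x \<and> c x = i"
  shows "card I \<le> card {x\<in>X. adj u x}"
proof (rule surj_card_le)
  show "I \<subseteq> c ` {x\<in>X. adj u x}" using assms(2) by fastforce
qed (use assms(1) in auto)

text \<open>Choose \<open>v\<close> with the longest shortest chain \<open>lev v\<close>. Shortest
  chains from the other accessible classes then avoid \<open>v\<close>, so these classes stay
  accessible whatever happens to \<open>v\<close>.\<close>

lemma terminal_class:
  assumes st: "state c z"
  obtains v where "v \<in> Acc c z"
    and "\<And>c' z'. (\<And>k. k \<in> Acc c z \<Longrightarrow> k \<noteq> v \<Longrightarrow> cls c' z' k = cls c z k) \<Longrightarrow> Acc c z - {v} \<subseteq> Acc c' z'"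
    and "Suc (card (cls c z v)) = s \<or> (\<exists>u\<in>cls c z v. \<exists>j\<in>Acc c z - {v}. free c z u j)"
proof -
  define lev where "lev i = (LEAST n. acc c z n i)" for i
  have lev: "acc c z (lev i) i" if "i \<in> Acc c z" for i
    using that unfolding Acc_def lev_def by (auto intro: LeastI)
  have below: "\<not> acc c z m i" if "m < lev i" for m i
    using that not_less_Least unfolding lev_def by blast
  have "Max (lev ` Acc c z) \<in> lev ` Acc c z"
    using Acc_nonempty[OF st] by (intro Max_in) auto
  then obtain v where v: "v \<in> Acc c z" "lev v = Max (lev ` Acc c z)" by auto
  have mx: "lev i \<le> lev v" if "i \<in> Acc c z" for i
    using that unfolding v(2) by (intro Max_ge) auto
  have P1: "Acc c z - {v} \<subseteq> Acc c' z'"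
    if same: "\<And>k. k \<in> Acc c z \<Longrightarrow> k \<noteq> v \<Longrightarrow> cls c' z' k = cls c z k" for c' z'
  proof
    fix i assume i: "i \<in> Acc c z - {v}"
    have "acc c' z' (lev i) i"
    proof (rule acc_mono[where v = v and c = c and z = z])
      show "\<not> acc c z m v" if "m < lev i" for m using below[of m v] mx[of i] that i by auto
    qed (use same i lev in auto)
    then show "i \<in> Acc c' z'" by (rule AccI)
  qed
  have P2: "Suc (card (cls c z v)) = s \<or> (\<exists>u\<in>cls c z v. \<exists>j\<in>Acc c z - {v}. free c z u j)"
  proof (cases "lev v")
    case 0
    then show ?thesis using lev[OF v(1)] by simp
  next
    case (Suc n)
    then obtain u j where u: "u \<in> cls c z v" "acc c z n j" "free c z u j"
      using lev[OF v(1)] by auto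
    then have "j \<noteq> v" using below[of n v] Suc by auto
    then show ?thesis using u AccI by blast
  qed
  show thesis using that[OF v(1) P1 P2] by blast
qed

text \<open>Exchanging \<open>w\<close> for \<open>y\<close> in class \<open>v\<close> keeps
  \<open>v\<close> accessible: a small class stays small, and otherwise the vertex \<open>u\<close>
  that can be shifted out of \<open>v\<close> is not \<open>w\<close>, which fits into no other
  accessible class.\<close>

lemma Acc_replace:
  assumes v: "v \<in> Acc c z"
    and tmn: "\<And>c' z'. (\<And>k. k \<in> Acc c z \<Longrightarrow> k \<noteq> v \<Longrightarrow> cls c' z' k = cls c z k) \<Longrightarrow> Acc c z - {v} \<subseteq> Acc c' z'"
    and wit: "Suc (card (cls c z v)) = s \<or> (\<exists>u\<in>cls c z v. \<exists>j\<in>Acc c z - {v}. free c z u j)"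
    and w: "w \<in> cls c z v" "\<And>j. j \<in> Acc c z - {v} \<Longrightarrow> \<not> free c z w j"
    and same: "\<And>k. k \<in> Acc c z \<Longrightarrow> k \<noteq> v \<Longrightarrow> cls c' z' k = cls c z k"
    and new: "cls c' z' v = insert y (cls c z v - {w})" "y \<notin> cls c z v"
  shows "Acc c z \<subseteq> Acc c' z'"
proof -
  have sub: "Acc c z - {v} \<subseteq> Acc c' z'" using tmn[of c' z'] same by blast
  have vr: "v < r" using v Acc_subset by blast
  have "v \<in> Acc c' z'"
    using wit
  proof
    assume "Suc (card (cls c z v)) = s"
    moreover have "card (insert y (cls c z v - {w})) = card (cls c z v)"
      using w new(2) card_Suc_Diff1[of "cls c z v" w] by simp
    ultimately show ?thesis using vr new(1) by (intro small_in_Acc) auto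
  next
    assume "\<exists>u\<in>cls c z v. \<exists>j\<in>Acc c z - {v}. free c z u j"
    then obtain u j where u: "u \<in> cls c z v" "j \<in> Acc c z - {v}" "free c z u j" by blast
    then have "u \<noteq> w" using w(2) by blast
    then have "u \<in> cls c' z' v" using u new by simp
    moreover have "free c' z' u j" using u same[of j] by (simp add: free_def)
    ultimately show ?thesis using Acc_step vr u(2) sub by blast
  qed
  then show ?thesis using sub by blast
qed

text \<open>
  Halving the weight of \<open>D\<close> relative to \<open>Q\<close> is what makes the
  loss from classes without neighbours of \<open>w\<close> the same inside and outside \<open>R\<close>.
\<close>

lemma solo_counting:
  assumes fin: "finite K" "finite Q" "finite D"
    and domQ: "\<And>u. u \<in> Q \<Longrightarrow> \<exists>k\<in>K. adj k u"
    and domD: "\<And>u. u \<in> D \<Longrightarrow> \<exists>k\<in>K. adj k u"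
    and K: "card K \<le> s" and Q: "card Q = b * s + 1" and D: "card D = m * s"
  shows "\<exists>w\<in>K. 2 * b + m + 1 \<le>
      card {u\<in>Q. adj w u \<and> (\<forall>k\<in>K. adj k u \<longrightarrow> k = w)} + card {u\<in>Q. adj w u} + card {u\<in>D. adj w u}"
proof (rule ccontr)
  let ?solo = "\<lambda>w u. adj w u \<and> (\<forall>k\<in>K. adj k u \<longrightarrow> k = w)"
  assume neg: "\<not> ?thesis"
  have le: "card {u\<in>Q. ?solo w u} + card {u\<in>Q. adj w u} + card {u\<in>D. adj w u} \<le> 2 * b + m"
    if "w \<in> K" for w
  proof -
    have "\<not> 2 * b + m + 1 \<le> card {u\<in>Q. ?solo w u} + card {u\<in>Q. adj w u} + card {u\<in>D. adj w u}"
      using neg that by blast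
    then show ?thesis by linarith
  qed
  have swap: "(\<Sum>w\<in>K. card {u\<in>Y. P w u}) = (\<Sum>u\<in>Y. card {w\<in>K. P w u})"
    if "finite Y" for Y and P :: "'a \<Rightarrow> 'a \<Rightarrow> bool"
    by (rule sum_multicount_gen) (use fin that in auto)
  \<comment> \<open>A vertex with a single neighbour in \<open>K\<close> is a solo neighbour of it
    and hence is counted in both terms.\<close>
  have two: "2 \<le> card {w\<in>K. ?solo w u} + card {w\<in>K. adj w u}" if u: "u \<in> Q" for u
  proof -
    obtain k where k: "k \<in> K" "adj k u" using domQ u by blast
    show ?thesis
    proof (cases "{w\<in>K. adj w u} = {k}")
      case True
      then have "?solo k u" by blast
      then have "{k} \<subseteq> {w\<in>K. ?solo w u}" using k by blast
      then have "card {k} \<le> card {w\<in>K. ?solo w u}" using fin(1) by (intro card_mono) auto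
      then show ?thesis using True by simp
    next
      case False
      then obtain l where "l \<in> K" "adj l u" "l \<noteq> k" using k by blast
      then have "{k, l} \<subseteq> {w\<in>K. adj w u}" "card {k, l} = 2" using k by auto
      then have "2 \<le> card {w\<in>K. adj w u}" using fin(1) card_mono[of "{w\<in>K. adj w u}" "{k,l}"] by auto
      then show ?thesis by simp
    qed
  qed
  have one: "1 \<le> card {w\<in>K. adj w u}" if u: "u \<in> D" for u
  proof -
    have "{w\<in>K. adj w u} \<noteq> {}" using domD u by blast
    then show ?thesis using fin(1) by (simp add: Suc_le_eq card_gt_0_iff)
  qed
  \<comment> \<open>The left side is \<open>s * (2 * b + m) + 2\<close>; the excess 2 comes from the
    token in \<open>Q\<close> and contradicts the sum of the bounds \<open>le\<close>.\<close>
  have "2 * card Q + card D \<le> (\<Sum>u\<in>Q. card {w\<in>K. ?solo w u} + card {w\<in>K. adj w u}) + (\<Sum>u\<in>D. card {w\<in>K. adj w u})"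
  proof (rule add_mono)
    have "(\<Sum>u\<in>Q. 2) \<le> (\<Sum>u\<in>Q. card {w\<in>K. ?solo w u} + card {w\<in>K. adj w u})"
      by (intro sum_mono two)
    then show "2 * card Q \<le> (\<Sum>u\<in>Q. card {w\<in>K. ?solo w u} + card {w\<in>K. adj w u})" by simp
    have "(\<Sum>u\<in>D. 1) \<le> (\<Sum>u\<in>D. card {w\<in>K. adj w u})" by (intro sum_mono one)
    then show "card D \<le> (\<Sum>u\<in>D. card {w\<in>K. adj w u})" by simp
  qed
  also have "\<dots> = (\<Sum>w\<in>K. card {u\<in>Q. ?solo w u} + card {u\<in>Q. adj w u} + card {u\<in>D. adj w u})"
    using swap[OF fin(2), of ?solo] swap[OF fin(2), of adj] swap[OF fin(3), of adj]
    by (simp add: sum.distrib)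
  also have "\<dots> \<le> card K * (2 * b + m)" using sum_mono[OF le, of K] by simp
  also have "\<dots> \<le> s * (2 * b + m)" using K by simp
  finally show False unfolding Q D by (simp add: algebra_simps)
qed

end

section \<open>Sparse graphs: a maximal state cannot exist\<close>

locale sparse_coloring = token_coloring +
  fixes m1 m2 \<alpha> :: real
  assumes degree_le: "v \<in> V \<Longrightarrow> card {u\<in>V. adj v u} \<le> r"
    and low_degree: "W \<subseteq> V \<Longrightarrow> W \<noteq> {} \<Longrightarrow> \<exists>u\<in>W. real (card {x\<in>W. adj u x}) \<le> 2 * m1"
    and cut_le: "X \<subseteq> V \<Longrightarrow> Y \<subseteq> V \<Longrightarrow> X \<inter> Y = {} \<Longrightarrow>
        real (\<Sum>u\<in>X. card {x\<in>Y. adj u x}) \<le> m2 * real (card X + card Y)"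
    and alpha: "0 \<le> \<alpha>" "\<alpha> \<le> 1/4"
    and m1_le: "2 * m1 \<le> (1 - 3 * \<alpha>) * real r"
    and m2_le: "m2 \<le> \<alpha> * (1 - \<alpha>) * real r"
begin

text \<open>Classes in \<open>Rch c z\<close> are not accessible, hence not small; the 1 counts
  \<open>z\<close>.\<close>

lemma card_Tok:
  assumes st: "state c z" and ne: "\<not> has_equitable V adj r"
  shows "card (Tok c z) = card (Rch c z) * s + 1"
proof -
  have fin: "finite (Rch c z)" using Rch_subset finite_subset by blast
  have "card (cls c z j) = s" if "j \<in> Rch c z" for j
    using card_cls_not_Acc[OF st, of j] that Rch_Acc_disjoint[OF st ne] Rch_subset by blast
  then have "card (\<Union>j\<in>Rch c z. cls c z j) = card (Rch c z) * s" by (intro card_Union_cls fin)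
  moreover have "z \<notin> (\<Union>j\<in>Rch c z. cls c z j)" by (auto simp: cls_def)
  ultimately show ?thesis using fin by (simp add: Tok_eq[OF st])
qed

text \<open>Each of the \<open>b * s + 1\<close> possible tokens has at least \<open>r - b\<close>
  neighbours outside \<open>Tok c z\<close>, one in each class outside \<open>Rch c z\<close>. If
  \<open>b\<close> were at most \<open>(1 - \<alpha>) * r\<close>, this would exceed the bound on
  the edges of this cut.\<close>

lemma card_Rch_large:
  assumes st: "state c z" and ne: "\<not> has_equitable V adj r"
    and valid: "\<alpha> * real r \<le> real (card {j. free c z z j})"
  shows "(1 - \<alpha>) * real r < real (card (Rch c z))"
proof (rule ccontr)
  assume neg: "\<not> ?thesis"
  let ?R = "Rch c z" and ?Q = "Tok c z"
  define b where "b = card ?R"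
  have finR: "finite ?R" using Rch_subset finite_subset by blast
  have QV: "?Q \<subseteq> V" by (rule Tok_subset[OF st])
  obtain k where k: "k \<in> Acc c z" using Acc_nonempty[OF st] by blast
  then have "k \<in> {..<r} - ?R" using Rch_Acc_disjoint[OF st ne] Acc_subset by blast
  then have "?R \<subset> {..<r}" using Rch_subset by blast
  then have br: "b < r" using psubset_card_mono[of "{..<r}" ?R] by (simp add: b_def)
  have "card {j. free c z z j} \<le> b" unfolding b_def by (rule card_mono[OF finR free_subset_Rch])
  then have lo: "\<alpha> * real r \<le> real b" using valid by linarith
  have hi: "real b \<le> (1 - \<alpha>) * real r" using neg by (simp add: b_def)
  have nb: "r - b \<le> card {x\<in>V - ?Q. adj u x}" if u: "u \<in> ?Q" for u
  proof -
    have "card ({..<r} - ?R) \<le> card {x\<in>V - ?Q. adj u x}"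
    proof (rule card_le_neighbours[where c = c])
      fix i assume i: "i \<in> {..<r} - ?R"
      then obtain x where x: "x \<in> cls c z i" "adj u x" using Tok_dominated[OF st u, of i] by auto
      then have "x \<in> V - ?Q" using i by (auto simp: Tok_eq[OF st] cls_def)
      then show "\<exists>x\<in>V - ?Q. adj u x \<and> c x = i" using x by (auto simp: cls_def)
    qed (use finite_V in auto)
    moreover have "card ({..<r} - ?R) = r - b" using finR Rch_subset by (simp add: card_Diff_subset b_def)
    ultimately show ?thesis by simp
  qed
  have cV: "card ?Q + card (V - ?Q) = card V"
    using QV finite_V by (metis card_Diff_subset card_mono finite_subset le_add_diff_inverse)
  have "(b * s + 1) * (r - b) \<le> (\<Sum>u\<in>?Q. card {x\<in>V - ?Q. adj u x})"
    using sum_mono[of ?Q "\<lambda>_. r - b", OF nb] by (simp add: card_Tok[OF st ne] b_def)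
  then have "real ((b * s + 1) * (r - b)) \<le> real (\<Sum>u\<in>?Q. card {x\<in>V - ?Q. adj u x})" by linarith
  also have "\<dots> \<le> m2 * real (card ?Q + card (V - ?Q))" by (rule cut_le) (use QV in auto)
  also have "\<dots> = m2 * real (card V)" by (simp only: cV)
  also have "\<dots> \<le> (\<alpha> * (1 - \<alpha>) * real r) * real (card V)" using m2_le by (intro mult_right_mono) auto
  also have "\<dots> \<le> (\<alpha> * (1 - \<alpha>) * real r) * real (r * s)"
    using card_V_le[OF st] alpha by (intro mult_left_mono) (auto simp del: of_nat_mult)
  also have "real ((b * s + 1) * (r - b)) = (real b * real s + 1) * (real r - real b)"
    unfolding of_nat_mult of_nat_add of_nat_diff[OF less_imp_le[OF br]] by simp
  finally have 1: "(real b * real s + 1) * (real r - real b) \<le> \<alpha> * (1 - \<alpha>) * real r * real r * real s"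
    by (simp add: mult.assoc)
  \<comment> \<open>\<open>b * (r - b)\<close> is concave in \<open>b\<close> and equals
    \<open>\<alpha> * (1 - \<alpha>) * r * r\<close> at both ends of the interval containing
    \<open>b\<close>.\<close>
  have "0 \<le> (real b - \<alpha> * real r) * ((1 - \<alpha>) * real r - real b)"
    using lo hi by (intro mult_nonneg_nonneg) auto
  then have "\<alpha> * (1 - \<alpha>) * real r * real r \<le> real b * (real r - real b)" by (simp add: algebra_simps)
  then have "\<alpha> * (1 - \<alpha>) * real r * real r * real s \<le> real b * (real r - real b) * real s"
    by (intro mult_right_mono) auto
  moreover have "real r - real b > 0" using br by simp
  ultimately show False using 1 by (simp add: algebra_simps)
qed

lemma no_maximal_state:
  assumes st: "state c z" and ne: "\<not> has_equitable V adj r"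
    and valid: "\<alpha> * real r \<le> real (card {j. free c z z j})"
    and maximal: "\<And>c' z'. state c' z' \<Longrightarrow> \<alpha> * real r \<le> real (card {j. free c' z' z' j}) \<Longrightarrow>
        card (Acc c' z') \<le> card (Acc c z)"
  shows False
proof -
  define Q R A where "Q = Tok c z" and "R = Rch c z" and "A = Acc c z"
  \<comment> \<open>The classes neither entered by tokens nor accessible; their vertices
    \<open>D\<close> also have neighbours in the class \<open>v\<close> chosen below.\<close>
  define M where "M = {..<r} - R - A"
  define D where "D = (\<Union>i\<in>M. cls c z i)"
  have RA: "R \<inter> A = {}" unfolding R_def A_def by (rule Rch_Acc_disjoint[OF st ne])
  have sub: "R \<subseteq> {..<r}" "A \<subseteq> {..<r}" unfolding R_def A_def by (rule Rch_subset Acc_subset)+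
  have fin: "finite R" "finite A" "finite M" using sub finite_subset by (auto simp: M_def)
  have QV: "Q \<subseteq> V" unfolding Q_def by (rule Tok_subset[OF st])
  have finQ: "finite Q" using QV finite_V finite_subset by blast
  have DV: "D \<subseteq> V" by (auto simp: D_def cls_def)
  have finD: "finite D" using DV finite_V finite_subset by blast
  have part: "card R + card M + card A = r"
  proof -
    have "{..<r} = R \<union> M \<union> A" using sub by (auto simp: M_def)
    then have "card (R \<union> M \<union> A) = r" by (metis card_lessThan)
    moreover have "card (R \<union> M \<union> A) = card R + card M + card A"
      using fin RA by (subst card_Un_disjoint, auto simp: M_def)+
    ultimately show ?thesis by simp
  qed
  have big: "(1 - \<alpha>) * real r < real (card R)" unfolding R_def by (rule card_Rch_large[OF st ne valid])
  obtain v where v: "v \<in> A"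
    and tmn: "\<And>c' z'. (\<And>k. k \<in> A \<Longrightarrow> k \<noteq> v \<Longrightarrow> cls c' z' k = cls c z k) \<Longrightarrow> A - {v} \<subseteq> Acc c' z'"
    and wit: "Suc (card (cls c z v)) = s \<or> (\<exists>u\<in>cls c z v. \<exists>j\<in>A - {v}. free c z u j)"
    using terminal_class[OF st] unfolding A_def by blast
  have vr: "v < r" and vR: "v \<notin> R" using v RA sub by auto
  define K where "K = cls c z v"
  have finK: "finite K" by (simp add: K_def)
  have KQ: "x \<notin> K" if "x \<in> Q" for x
    using that vR by (auto simp: Q_def R_def K_def Tok_eq[OF st] cls_def)
  have "\<exists>w\<in>K. 2 * card R + card M + 1 \<le>
      card {u\<in>Q. adj w u \<and> (\<forall>k\<in>K. adj k u \<longrightarrow> k = w)} + card {u\<in>Q. adj w u} + card {u\<in>D. adj w u}"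
  proof (rule solo_counting[OF finK finQ finD])
    show "\<exists>k\<in>K. adj k u" if "u \<in> Q" for u
      using Tok_dominated[OF st _ vr] that vR adj_sym unfolding Q_def R_def K_def by blast
    show "\<exists>k\<in>K. adj k u" if "u \<in> D" for u
    proof (rule ccontr)
      assume n: "\<not> ?thesis"
      obtain i where i: "i \<in> M" "u \<in> cls c z i" using \<open>u \<in> D\<close> by (auto simp: D_def)
      \<comment> \<open>Otherwise \<open>u\<close> could be shifted into \<open>v\<close>, and its
        class would be accessible.\<close>
      have "free c z u v" using n vr adj_sym by (auto simp: free_def K_def)
      then have "i \<in> A" using Acc_step[OF i(2)] i(1) v by (auto simp: M_def A_def)
      then show False using i by (simp add: M_def)
    qed
    have "card K = s \<or> Suc (card K) = s" using st vr by (auto simp: state_def K_def)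
    then show "card K \<le> s" by linarith
    show "card Q = card R * s + 1" unfolding Q_def R_def by (rule card_Tok[OF st ne])
    show "card D = card M * s" unfolding D_def
      by (rule card_Union_cls[OF fin(3)]) (auto simp: M_def A_def intro: card_cls_not_Acc[OF st])
  qed
  then obtain w where wK: "w \<in> K" and
    cnt: "2 * card R + card M + 1 \<le>
      card {u\<in>Q. adj w u \<and> (\<forall>k\<in>K. adj k u \<longrightarrow> k = w)} + card {u\<in>Q. adj w u} + card {u\<in>D. adj w u}"
    by blast
  define S N L where "S = {u\<in>Q. adj w u \<and> (\<forall>k\<in>K. adj k u \<longrightarrow> k = w)}"
    and "N = {u\<in>Q. adj w u}" and "L = {u\<in>D. adj w u}"
  have cnt: "2 * card R + card M + 1 \<le> card S + card N + card L"
    using cnt by (simp add: S_def N_def L_def)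
  have SN: "S \<subseteq> N" and NQ: "N \<subseteq> Q" by (auto simp: S_def N_def)
  have finN: "finite N" "finite S" using finQ finite_subset[of _ Q] by (auto simp: S_def N_def)
  have wV: "w \<in> V" using wK by (auto simp: K_def cls_def)
  have wQ: "w \<notin> Q" using KQ wK by blast
  have QD: "Q \<inter> D = {}" by (auto simp: Q_def D_def M_def R_def Tok_eq[OF st] cls_def)

  \<comment> \<open>A token \<open>y\<close> from \<open>S\<close> takes the place of
    \<open>w\<close>, its only neighbour in \<open>K\<close>, and \<open>w\<close> becomes the
    token.\<close>
  have swap: "state (c1(y := v)) w"
    "\<And>k. cls (c1(y := v)) w k = (if k = v then insert y (K - {w}) else cls c1 y k)"
    "\<And>k. k \<in> A \<Longrightarrow> k \<noteq> v \<Longrightarrow> cls (c1(y := v)) w k = cls c z k"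
    if y: "y \<in> S" and c1: "reach c z c1 y" for y c1
  proof -
    have st1: "state c1 y" by (rule reach_state[OF c1 st])
    have same: "cls c1 y k = cls c z k" if "k \<notin> R" for k
      using reach_cls_outside[OF c1 st] that by (simp add: R_def)
    have wc: "w \<in> cls c1 y v" using same[OF vR] wK by (simp add: K_def)
    show "state (c1(y := v)) w"
    proof (rule state_replace[OF st1 wc])
      fix u assume "u \<in> cls c1 y v" "adj y u"
      then show "u = w" using y same[OF vR] adj_sym by (auto simp: S_def K_def)
    qed
    have yV: "y \<in> V" using st1 by (simp add: state_def)
    show eq: "cls (c1(y := v)) w k = (if k = v then insert y (K - {w}) else cls c1 y k)" for k
      using cls_replace[OF yV wc, of k] same[OF vR] by (simp add: K_def)
    show "cls (c1(y := v)) w k = cls c z k" if "k \<in> A" "k \<noteq> v" for k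
      using eq[of k] same[of k] that RA by auto
  qed

  have r2: "real r < 2 * real (card R)"
  proof -
    have "(3/4) * real r \<le> (1 - \<alpha>) * real r" using alpha by (intro mult_right_mono) auto
    then show ?thesis using big by linarith
  qed
  have degw: "card N + card L + card {x\<in>V - Q - D. adj w x} \<le> r"
  proof -
    have "{u\<in>V. adj w u} = N \<union> L \<union> {x\<in>V - Q - D. adj w x}"
      using QV DV by (auto simp: N_def L_def)
    moreover have "card (N \<union> L \<union> {x\<in>V - Q - D. adj w x}) = card N + card L + card {x\<in>V - Q - D. adj w x}"
      using finN finD finite_V QD
      by (subst card_Un_disjoint, auto simp: N_def L_def)+
    ultimately show ?thesis using degree_le[OF wV] by simp
  qed
  have "S \<noteq> {}"
  proof
    assume "S = {}"
    then have "2 * card R < r" using cnt degw by simp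
    then show False using r2 by linarith
  qed
  \<comment> \<open>Otherwise exchange \<open>w\<close> with some \<open>y\<close> in
    \<open>S\<close> and put \<open>w\<close> into class \<open>i\<close>, which is still accessible
    by the choice of \<open>v\<close>.\<close>
  have stuck: "\<not> free c z w i" if i: "i \<in> A - {v}" for i
  proof
    assume f: "free c z w i"
    obtain y where y: "y \<in> S" using \<open>S \<noteq> {}\<close> by blast
    then obtain c1 where c1: "reach c z c1 y" using SN NQ by (auto simp: Q_def Tok_def)
    have "free (c1(y := v)) w w i" using f swap(3)[OF y c1, of i] i by (simp add: free_def)
    moreover have "i \<in> Acc (c1(y := v)) w" using tmn[of "c1(y := v)" w] swap(3)[OF y c1] i by blast
    ultimately show False using equitable_if_free_Acc[OF swap(1)[OF y c1]] ne by blast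
  qed
  \<comment> \<open>By \<open>stuck\<close>, \<open>w\<close> has a neighbour in each accessible
    class other than \<open>v\<close>; the degree bound leaves at most
    \<open>card R + card M + 1\<close> neighbours in \<open>Q\<close> and \<open>D\<close>.\<close>
  have "card (A - {v}) \<le> card {x\<in>V - Q - D. adj w x}"
  proof (rule card_le_neighbours[where c = c])
    fix i assume i: "i \<in> A - {v}"
    then obtain x where x: "x \<in> cls c z i" "adj w x" using stuck[OF i] sub by (auto simp: free_def)
    then have "x \<in> V - Q - D" using i RA
      by (auto simp: Q_def D_def M_def R_def Tok_eq[OF st] cls_def)
    then show "\<exists>x\<in>V - Q - D. adj w x \<and> c x = i" using x by (auto simp: cls_def)
  qed (use finite_V in auto)
  then have NL: "card N + card L \<le> card R + card M + 1"
    using degw part v fin by simp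
  have SR: "card R \<le> card S" using cnt NL card_mono[OF finN(1) SN] by linarith
  have m1R: "2 * m1 < real (card R)"
  proof -
    have "(1 - 3 * \<alpha>) * real r \<le> (1 - \<alpha>) * real r" using alpha by (intro mult_right_mono) auto
    then show ?thesis using big m1_le by linarith
  qed

  define W where "W = insert w S"
  have finW: "finite W" using finN by (simp add: W_def)
  have "W \<subseteq> V" using wV SN NQ QV by (auto simp: W_def)
  then obtain y where y: "y \<in> W" "real (card {x\<in>W. adj y x}) \<le> 2 * m1"
    using low_degree[of W] by (auto simp: W_def)
  have "y \<noteq> w"
  proof
    assume "y = w"
    then have "S \<subseteq> {x\<in>W. adj y x}" by (auto simp: W_def S_def)
    then have "card S \<le> card {x\<in>W. adj y x}" using finW by (intro card_mono) auto
    then show False using SR m1R y(2) by linarith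
  qed
  then have yS: "y \<in> S" using y by (simp add: W_def)
  have yK: "y \<notin> K" using KQ yS SN NQ by blast
  have wS: "w \<notin> S" using wQ SN NQ by blast
  have yw: "adj y w" using yS adj_sym by (auto simp: S_def)
  obtain c1 where c1: "reach c z c1 y" using yS SN NQ by (auto simp: Q_def Tok_def)
  define c2 where "c2 = c1(y := v)"
  note swap = swap[OF yS c1, folded c2_def]
  have cls2: "cls c2 w v = insert y (K - {w})" by (simp add: swap(2))
  have A2: "A \<subseteq> Acc c2 w"
    unfolding A_def
  proof (rule Acc_replace[where v = v and w = w and y = y])
    show "cls c2 w v = insert y (cls c z v - {w})" using cls2 by (simp add: K_def)
  qed (use v tmn wit wK stuck swap(3) yK in \<open>auto simp: A_def K_def\<close>)
  define H where "H = {j. free c2 w w j}"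
  have Hr: "H \<subseteq> {..<r}" by (auto simp: H_def free_def)
  have solo: "\<not> adj u x" if "u \<in> S" "x \<in> K" "x \<noteq> w" for u x
    using that adj_sym by (auto simp: S_def)

  \<comment> \<open>Otherwise \<open>y\<close> is adjacent to all of \<open>S - {y}\<close> and to
    \<open>w\<close>, so it has at least \<open>card S\<close> neighbours in \<open>W\<close>, more
    than \<open>2 * m1\<close>.\<close>
  obtain y' where y': "y' \<in> S" "y' \<noteq> y" "\<not> adj y y'"
  proof (rule ccontr)
    assume "\<not> thesis"
    then have "insert w (S - {y}) \<subseteq> {x\<in>W. adj y x}" using that yw by (auto simp: W_def)
    then have "card (insert w (S - {y})) \<le> card {x\<in>W. adj y x}" using finW by (intro card_mono) auto
    moreover have "card (insert w (S - {y})) = card S"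
      using wS yS finN card_Suc_Diff1[of S y] by simp
    ultimately show False using SR m1R y(2) by linarith
  qed
  \<comment> \<open>After the exchange \<open>y'\<close> fits into class \<open>v\<close>, where
    \<open>y\<close> has replaced its only neighbour \<open>w\<close>. So the class of
    \<open>y'\<close>, which lies in \<open>R\<close>, becomes accessible as well, and maximality
    excludes that \<open>w\<close> fits into enough classes.\<close>
  have "\<not> \<alpha> * real r \<le> real (card H)"
  proof
    assume "\<alpha> * real r \<le> real (card H)"
    then have le: "card (Acc c2 w) \<le> card A"
      using maximal[OF swap(1)] by (simp add: H_def A_def)
    have cy: "c1 y' \<in> R" "y' \<in> cls c1 y (c1 y')"
      using Tok_color[OF st c1, of y'] y' SN NQ by (auto simp: R_def Q_def)
    then have "y' \<in> cls c2 w (c1 y')" using vR swap(2)[of "c1 y'"] by auto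
    moreover have "free c2 w y' v"
      using solo[OF y'(1)] y' adj_sym vr by (auto simp: free_def cls2)
    ultimately have "c1 y' \<in> Acc c2 w" using Acc_step[of y' c2 w "c1 y'" v] A2 v cy sub by auto
    then have "A \<subset> Acc c2 w" using A2 cy(1) RA by blast
    then show False using le psubset_card_mono[of "Acc c2 w" A] by simp
  qed
  then have h: "real (card H) < \<alpha> * real r" by simp

  define X where "X = N - {y}"
  \<comment> \<open>The members of \<open>X\<close> that are the only neighbour of \<open>w\<close>
    in their class once \<open>y\<close> is the token.\<close>
  define U where "U = {u\<in>X. \<forall>u'\<in>X. c1 u' = c1 u \<longrightarrow> u' = u}"
  have finX: "finite X" using finN by (simp add: X_def)
  have inX: "x \<in> X \<and> c1 x = j" if "x \<in> cls c1 y j" "j \<in> R" "adj w x" for x j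
    using cls_subset_Tok[OF st c1 that(1)] that by (auto simp: X_def N_def Q_def R_def cls_def)
  have "R - H \<subseteq> c1 ` X"
  proof
    fix j assume j: "j \<in> R - H"
    then obtain x where "x \<in> cls c2 w j" "adj w x" using sub by (auto simp: H_def free_def)
    then have "x \<in> X \<and> c1 x = j" using inX[of x j] swap(2)[of j] j vR by (auto split: if_splits)
    then show "j \<in> c1 ` X" by blast
  qed
  then have "card (R - H) \<le> card (c1 ` X)" using finX by (intro card_mono) auto
  then have U1: "2 * card (R - H) \<le> card X + card U"
    using twice_card_image_le[OF finX, of c1] by (simp add: U_def)
  have X1: "card X + 1 = card N"
    using yS SN finN card_Suc_Diff1[of N y] by (auto simp: X_def)

  have TW: "insert w (U \<inter> S) \<subseteq> {x\<in>W. adj y x}"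
  proof -
    \<comment> \<open>Otherwise \<open>w\<close> replaces \<open>u\<close> in class
      \<open>j\<close>, and the new token \<open>u\<close> fits into the accessible class
      \<open>v\<close>, which now contains \<open>y\<close> instead of \<open>w\<close>.\<close>
    have "adj y u" if u: "u \<in> U" "u \<in> S" for u
    proof (rule ccontr)
      assume nadj: "\<not> adj y u"
      define j where "j = c1 u"
      have uy: "u \<noteq> y" using u by (auto simp: U_def X_def)
      have j: "j \<in> R" "u \<in> cls c1 y j"
        using Tok_color[OF st c1, of u] u uy SN NQ by (auto simp: R_def Q_def j_def)
      have jv: "j \<noteq> v" using j vR by blast
      then have u2: "u \<in> cls c2 w j" using j swap(2)[of j] by simp
      have st3: "state (c2(w := j)) u"
      proof (rule state_replace[OF swap(1) u2])
        fix x assume "x \<in> cls c2 w j" "adj w x"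
        then have "x \<in> X \<and> c1 x = j" using inX[of x j] swap(2)[of j] j jv by auto
        then show "x = u" using u(1) by (auto simp: U_def j_def)
      qed
      have eq3: "cls (c2(w := j)) u k = cls c2 w k" if "k \<noteq> j" for k
        using cls_replace[OF wV u2, of k] that by simp
      have "A \<subseteq> Acc (c2(w := j)) u"
        unfolding A_def
      proof (rule Acc_replace[where v = v and w = w and y = y])
        show "cls (c2(w := j)) u v = insert y (cls c z v - {w})"
          using cls2 eq3[of v] jv by (simp add: K_def)
        fix k assume "k \<in> Acc c z" "k \<noteq> v"
        then show "cls (c2(w := j)) u k = cls c z k"
          using swap(3)[of k] eq3[of k] j RA by (auto simp: A_def)
      qed (use v tmn wit wK stuck yK in \<open>auto simp: A_def K_def\<close>)
      moreover have "free (c2(w := j)) u u v"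
        using solo[OF u(2)] nadj adj_sym vr eq3[of v] jv by (auto simp: free_def cls2)
      ultimately show False using equitable_if_free_Acc[OF st3] v ne by blast
    qed
    then show ?thesis using yw by (auto simp: W_def)
  qed
  have T1: "real (card (U \<inter> S) + 1) \<le> 2 * m1"
  proof -
    have "card (insert w (U \<inter> S)) \<le> card {x\<in>W. adj y x}" using TW finW by (intro card_mono) auto
    moreover have "card (insert w (U \<inter> S)) = card (U \<inter> S) + 1" using wS finN by simp
    ultimately show ?thesis using y(2) by linarith
  qed
  have U2: "card U \<le> card (U \<inter> S) + (card N - card S)"
  proof -
    have "U \<subseteq> (U \<inter> S) \<union> (N - S)" by (auto simp: U_def X_def)
    then have "card U \<le> card ((U \<inter> S) \<union> (N - S))" using finN by (intro card_mono) auto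
    also have "\<dots> \<le> card (U \<inter> S) + card (N - S)" by (rule card_Un_le)
    finally show ?thesis using SN finN by (simp add: card_Diff_subset)
  qed
  have L1: "card (M - H) \<le> card L"
    unfolding L_def
  proof (rule card_le_neighbours[OF finD, where c = c])
    fix i assume i: "i \<in> M - H"
    then have "i \<noteq> v" "i \<notin> R" "i < r" using v by (auto simp: M_def)
    moreover obtain x where x: "x \<in> cls c2 w i" "adj w x" using i by (auto simp: H_def free_def M_def)
    ultimately have "x \<in> cls c z i"
      using swap(2)[of i] reach_cls_outside[OF c1 st, of i] by (simp add: R_def)
    then show "\<exists>x\<in>D. adj w x \<and> c x = i" using x i by (auto simp: D_def cls_def)
  qed
  have RM: "card R + card M \<le> card (R - H) + card (M - H) + card H"
  proof -
    have "card (R \<union> M) \<le> card ((R - H) \<union> (M - H) \<union> H)"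
      using fin finite_subset[OF Hr] by (intro card_mono) auto
    also have "\<dots> \<le> card (R - H) + card (M - H) + card H"
      by (meson card_Un_le add_le_mono1 order_trans)
    also have "card (R \<union> M) = card R + card M" using fin by (intro card_Un_disjoint) (auto simp: M_def)
    finally show ?thesis .
  qed
  have RH: "card (R - H) \<le> card R" "card (M - H) \<le> card M" using fin by (auto intro: card_mono)
  \<comment> \<open>Eliminating \<open>N\<close>, \<open>S\<close> and \<open>L\<close> leaves
    \<open>2 * card (R - H) + 2 * card (M - H)\<close> minus \<open>card R + 2 * card M + 1\<close>
    as a lower bound for \<open>card (U \<inter> S)\<close>; a class of \<open>H\<close> costs 2
    whether it lies in \<open>R\<close> or in \<open>M\<close>.\<close>
  have "card R \<le> card (U \<inter> S) + 1 + 2 * card H"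
    using cnt NL U1 X1 U2 L1 RM RH card_mono[OF finN(1) SN] by linarith
  then have "real (card R) \<le> 2 * m1 + 2 * real (card H)" using T1 by linarith
  moreover have "(1 - \<alpha>) * real r = (1 - 3 * \<alpha>) * real r + 2 * (\<alpha> * real r)" by (simp add: algebra_simps)
  ultimately show False using h big m1_le by linarith
qed

text \<open>There are at most \<open>r\<close> accessible classes, so some state with enough free
  classes for its token has the most.\<close>

lemma equitable_if_valid_state:
  assumes "state c z" "\<alpha> * real r \<le> real (card {j. free c z z j})"
  shows "has_equitable V adj r"
proof (rule ccontr)
  assume ne: "\<not> ?thesis"
  let ?P = "\<lambda>(c, z). state c z \<and> \<alpha> * real r \<le> real (card {j. free c z z j})"
  define f where "f = (\<lambda>(c, z). card (Acc c z))"
  have P: "?P (c, z)" using assms by simp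
  have "card (Acc c z) \<le> r" for c z using card_mono[OF _ Acc_subset, of c z] by simp
  then have bound: "\<forall>q. ?P q \<longrightarrow> f q < Suc r" by (auto simp: f_def less_Suc_eq_le)
  have "\<exists>p. ?P p \<and> (\<forall>q. ?P q \<longrightarrow> f q \<le> f p)"
    using Lattices_Big.ex_has_greatest_nat[of ?P "(c, z)" f "Suc r", OF P bound] .
  then obtain c' z' where "?P (c', z')" and "\<And>q. ?P q \<Longrightarrow> f q \<le> f (c', z')"
    by auto
  then show False using no_maximal_state[of c' z', OF _ ne] by (auto simp: f_def)
qed

end

section \<open>Induction on the vertex set\<close>

lemma sparse_coloring_subset:
  assumes "sparse_coloring V adj r m1 m2 \<alpha>" "V' \<subseteq> V"
  shows "sparse_coloring V' adj r m1 m2 \<alpha>"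
proof -
  \<comment> \<open>The class size is not an argument of the locale predicate; 0 is a dummy
    value.\<close>
  interpret sparse_coloring V adj r 0 m1 m2 \<alpha> by (rule assms(1))
  show ?thesis
  proof unfold_locales
    show "finite V'" using finite_V assms(2) finite_subset by blast
    show "card {u\<in>V'. adj v u} \<le> r" if "v \<in> V'" for v
    proof -
      have "card {u\<in>V'. adj v u} \<le> card {u\<in>V. adj v u}"
        using finite_V assms(2) by (intro card_mono) auto
      then show ?thesis using degree_le[of v] that assms(2) by fastforce
    qed
    show "\<exists>u\<in>W. real (card {x\<in>W. adj u x}) \<le> 2 * m1" if "W \<subseteq> V'" "W \<noteq> {}" for W
      using low_degree[of W] that assms(2) by blast
    show "real (\<Sum>u\<in>X. card {x\<in>Y. adj u x}) \<le> m2 * real (card X + card Y)"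
      if "X \<subseteq> V'" "Y \<subseteq> V'" "X \<inter> Y = {}" for X Y
      using cut_le[of X Y] that assms(2) by blast
  qed (use adj_sym adj_irrefl alpha m1_le m2_le in auto)
qed

text \<open>With \<open>x\<close> as token, its at most \<open>2 * m1\<close> neighbours block at
  most \<open>(1 - 3 * \<alpha>) * r\<close> classes, so at least \<open>\<alpha> * r\<close>
  classes are free for it.\<close>

lemma equitable_add_vertex:
  assumes sp: "sparse_coloring V adj r m1 m2 \<alpha>" and "0 < r"
    and x: "x \<in> V" "real (card {u\<in>V. adj x u}) \<le> 2 * m1"
    and eq: "has_equitable (V - {x}) adj r"
  shows "has_equitable V adj r"
proof -
  obtain c where c: "\<And>v. v \<in> V - {x} \<Longrightarrow> c v < r"
    "\<And>u v. u \<in> V - {x} \<Longrightarrow> v \<in> V - {x} \<Longrightarrow> adj u v \<Longrightarrow> c u \<noteq> c v"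
    "\<And>i j. i < r \<Longrightarrow> j < r \<Longrightarrow> card {v\<in>V - {x}. c v = i} \<le> card {v\<in>V - {x}. c v = j} + 1"
    using eq unfolding has_equitable_def by blast
  define f where "f i = card {v\<in>V - {x}. c v = i}" for i
  have "Min (f ` {..<r}) \<in> f ` {..<r}" using \<open>0 < r\<close> by (intro Min_in) auto
  then obtain k where k: "k < r" "f k = Min (f ` {..<r})" by auto
  have kle: "f k \<le> f i" if "i < r" for i unfolding k(2) using that by (intro Min_le) auto
  \<comment> \<open>One more than the smallest class size, so that a small class exists even if all
    classes have equal size.\<close>
  define s where "s = Suc (f k)"
  interpret sparse_coloring V adj r s m1 m2 \<alpha> by (rule sp)
  have cls: "cls c x i = {v\<in>V - {x}. c v = i}" for i by (auto simp: cls_def)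
  have sz: "card (cls c x i) = s \<or> Suc (card (cls c x i)) = s" if "i < r" for i
    using kle[OF that] c(3)[OF that k(1)] unfolding cls s_def f_def by linarith
  have st: "state c x"
    unfolding state_def using x(1) c sz k(1) by (auto simp: cls s_def f_def)
  have "{..<r} \<subseteq> {j. free c x x j} \<union> c ` {u\<in>V. adj x u}"
    by (auto simp: free_def cls_def)
  then have "card {..<r} \<le> card ({j. free c x x j} \<union> c ` {u\<in>V. adj x u})"
    using finite_V by (intro card_mono) (auto simp: free_def)
  also have "\<dots> \<le> card {j. free c x x j} + card (c ` {u\<in>V. adj x u})" by (rule card_Un_le)
  also have "card (c ` {u\<in>V. adj x u}) \<le> card {u\<in>V. adj x u}" using finite_V by (simp add: card_image_le)
  finally have "real r \<le> real (card {j. free c x x j}) + 2 * m1" using x(2) by simp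
  moreover have "0 \<le> \<alpha> * real r" using alpha by simp
  moreover have "(1 - 3 * \<alpha>) * real r = real r - 3 * (\<alpha> * real r)" by (simp add: algebra_simps)
  ultimately have "\<alpha> * real r \<le> real (card {j. free c x x j})" using m1_le by linarith
  then show ?thesis by (rule equitable_if_valid_state[OF st])
qed

lemma sparse_equitable:
  assumes "sparse_coloring V adj r m1 m2 \<alpha>" "0 < r"
  shows "has_equitable V adj r"
proof -
  have "finite V" using assms(1) by (simp add: sparse_coloring_def token_coloring_def)
  then show ?thesis using assms(1)
  proof (induction V rule: finite_psubset_induct)
    case (psubset V)
    show ?case
    proof (cases "V = {}")
      case True
      then show ?thesis using \<open>0 < r\<close> by (auto simp: has_equitable_def)
    next
      case False
      interpret sparse_coloring V adj r 0 m1 m2 \<alpha> by (rule psubset.prems)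
      obtain x where x: "x \<in> V" "real (card {u\<in>V. adj x u}) \<le> 2 * m1"
        using low_degree[of V] False by blast
      have "has_equitable (V - {x}) adj r"
        by (rule psubset.IH) (use x sparse_coloring_subset[OF psubset.prems] in auto)
      then show ?thesis using equitable_add_vertex[OF psubset.prems \<open>0 < r\<close> x] by blast
    qed
  qed
qed

section \<open>From the graph class to the assumptions of the locale\<close>

context
  fixes m1 m2 :: real and V :: "'a set" and E :: "'a set set"
  assumes gc: "graph_class m1 m2 V E"
begin

lemma edge_subset: "e \<in> E \<Longrightarrow> e \<subseteq> V" and card_edge: "e \<in> E \<Longrightarrow> card e = 2"
  and finite_vertices: "finite V"
  using gc by (auto simp: graph_class_def simple_graph_def)

lemma finite_edges: "finite E"
  by (rule finite_subset[of _ "Pow V"]) (use edge_subset finite_vertices in auto)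

lemma not_loop: "{u, u} \<notin> E"
  using card_edge[of "{u, u}"] by auto

lemma card_neighbours_le:
  "card {x\<in>W. {u, x} \<in> E} \<le> card {e\<in>E. u \<in> e \<and> e \<subseteq> insert u W}"
proof -
  have "inj_on (\<lambda>x. {u, x}) {x\<in>W. {u, x} \<in> E}" by (auto simp: inj_on_def doubleton_eq_iff)
  moreover have "(\<lambda>x. {u, x}) ` {x\<in>W. {u, x} \<in> E} \<subseteq> {e\<in>E. u \<in> e \<and> e \<subseteq> insert u W}" by auto
  ultimately show ?thesis using finite_edges by (intro card_inj_on_le) auto
qed

text \<open>The average degree in the subgraph induced by \<open>W\<close> is at most
  \<open>2 * m1\<close>.\<close>

lemma exists_low_degree:
  assumes W: "W \<subseteq> V" "W \<noteq> {}"
  shows "\<exists>u\<in>W. real (card {x\<in>W. {u, x} \<in> E}) \<le> 2 * m1"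
proof (rule ccontr)
  assume neg: "\<not> ?thesis"
  have finW: "finite W" using W finite_vertices finite_subset by blast
  define F where "F = {e\<in>E. e \<subseteq> W}"
  have finF: "finite F" using finite_edges by (simp add: F_def)
  have "subgraph W F V E" using W by (auto simp: subgraph_def F_def)
  then have m: "real (card F) \<le> m1 * real (card W)" using gc by (auto simp: graph_class_def)
  have "2 * m1 * real (card W) = (\<Sum>u\<in>W. 2 * m1)" by simp
  also have "\<dots> < (\<Sum>u\<in>W. real (card {x\<in>W. {u, x} \<in> E}))"
    using finW W neg by (intro sum_strict_mono) (auto simp: not_le)
  also have "\<dots> \<le> (\<Sum>u\<in>W. real (card {e\<in>F. u \<in> e}))"
  proof (rule sum_mono)
    fix u assume "u \<in> W"
    then have "{e\<in>E. u \<in> e \<and> e \<subseteq> insert u W} = {e\<in>F. u \<in> e}" by (auto simp: F_def insert_absorb)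
    then show "real (card {x\<in>W. {u, x} \<in> E}) \<le> real (card {e\<in>F. u \<in> e})"
      using card_neighbours_le[of W u] by simp
  qed
  also have "\<dots> = real (\<Sum>u\<in>W. card {e\<in>F. u \<in> e})" by simp
  also have "(\<Sum>u\<in>W. card {e\<in>F. u \<in> e}) = (\<Sum>e\<in>F. 2)"
  proof (rule sum_multicount_gen[OF finW finF], rule ballI)
    fix e assume "e \<in> F"
    then have "{i\<in>W. i \<in> e} = e" "card e = 2" using card_edge by (auto simp: F_def)
    then show "card {i\<in>W. i \<in> e} = 2" by simp
  qed
  finally show False using m by simp
qed

text \<open>The edges between \<open>X\<close> and \<open>Y\<close> form a bipartite subgraph, and
  disjointness makes each of them count only once in the sum.\<close>

lemma cut_bound:
  assumes "X \<subseteq> V" "Y \<subseteq> V" "X \<inter> Y = {}"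
  shows "real (\<Sum>u\<in>X. card {x\<in>Y. {u, x} \<in> E}) \<le> m2 * real (card X + card Y)"
proof -
  have fin: "finite X" "finite Y" using assms finite_vertices finite_subset by blast+
  define F where "F = {e\<in>E. \<exists>u\<in>X. \<exists>x\<in>Y. e = {u, x}}"
  have "subgraph (X \<union> Y) F V E" using assms by (auto simp: subgraph_def F_def)
  moreover have "bipartite (X \<union> Y) F"
    unfolding bipartite_def
  proof (intro exI[of _ X] conjI ballI)
    fix e assume "e \<in> F"
    then obtain u x where "u \<in> X" "x \<in> Y" "e = {u, x}" by (auto simp: F_def)
    then have "e \<inter> X = {u}" using assms(3) by auto
    then show "card (e \<inter> X) = 1" by simp
  qed simp
  ultimately have "real (card F) \<le> m2 * real (card (X \<union> Y))" using gc by (auto simp: graph_class_def)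
  moreover have "card (X \<union> Y) = card X + card Y" using fin assms(3) by (rule card_Un_disjoint)
  moreover have le: "(\<Sum>u\<in>X. card {x\<in>Y. {u, x} \<in> E}) \<le> card F"
  proof -
    let ?P = "SIGMA u:X. {x\<in>Y. {u, x} \<in> E}"
    have "(\<Sum>u\<in>X. card {x\<in>Y. {u, x} \<in> E}) = card ?P" using fin by simp
    also have "\<dots> \<le> card F"
    proof (rule card_inj_on_le)
      show "inj_on (\<lambda>(u, x). {u, x}) ?P" using assms(3) by (auto simp: inj_on_def doubleton_eq_iff)
      show "(\<lambda>(u, x). {u, x}) ` ?P \<subseteq> F" by (auto simp: F_def)
      show "finite F" using finite_edges by (simp add: F_def)
    qed
    finally show ?thesis .
  qed
  ultimately show ?thesis by (metis (no_types, lifting) of_nat_mono order_trans)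
qed

lemma card_neighbours_le_max_degree:
  assumes "v \<in> V"
  shows "card {u\<in>V. {v, u} \<in> E} \<le> max_degree V E"
proof -
  have "card {e\<in>E. v \<in> e \<and> e \<subseteq> insert v V} \<le> degree E v"
    unfolding degree_def using finite_edges by (intro card_mono) auto
  also have "\<dots> \<le> max_degree V E"
    unfolding max_degree_def using finite_vertices assms by (intro Max_ge) auto
  finally show ?thesis using card_neighbours_le[of V v] by simp
qed

lemma equitable_coloring_if_has_equitable:
  assumes "has_equitable V (\<lambda>u v. {u, v} \<in> E) r"
  shows "equitable_coloring V E r"
proof -
  obtain c where c: "\<forall>v\<in>V. c v < r" "\<forall>u\<in>V. \<forall>v\<in>V. {u, v} \<in> E \<longrightarrow> c u \<noteq> c v"
    "\<forall>i<r. \<forall>j<r. card {v\<in>V. c v = i} \<le> card {v\<in>V. c v = j} + 1"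
    using assms unfolding has_equitable_def by blast
  have "c u \<noteq> c v" if "e \<in> E" "u \<in> e" "v \<in> e" "u \<noteq> v" for e u v
  proof -
    have "{u, v} = e"
      using that card_edge[OF that(1)] finite_subset[OF edge_subset[OF that(1)] finite_vertices]
      by (intro card_subset_eq) auto
    then show ?thesis using c(2) that edge_subset[OF that(1)] by blast
  qed
  then show ?thesis unfolding equitable_coloring_def using c by blast
qed

end

theorem theorem1:
  fixes m1 m2 \<beta> :: real and V :: "'a set" and E :: "'a set set"
  assumes "m1 > 0" and "m2 > 0" and "m1 \<le> 1.8 * m2"
    and "0.5 \<le> \<beta>" and "\<beta> < 1"
    and "2 * m2 * (1 - \<beta>) * (1 + \<beta>)^2 - m1 * \<beta> * (2 + \<beta>) = 0"
    and "graph_class m1 m2 V E"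
    and "real (max_degree V E) \<ge> 2 / (1 - \<beta>) * m1"
  shows "\<forall>r::nat. r \<ge> max_degree V E \<longrightarrow> equitable_coloring V E r"
proof (intro allI impI)
  fix r :: nat assume r: "max_degree V E \<le> r"
  \<comment> \<open>With this choice the equation for \<open>\<beta>\<close> reads
    \<open>m2 * (1 - \<beta>) = 2 * m1 * \<alpha> * (1 - \<alpha>)\<close>, so the bound on
    \<open>m1\<close> yields the one on \<open>m2\<close>.\<close>
  define \<alpha> where "\<alpha> = \<beta> / (2 * (1 + \<beta>))"
  have b1: "0 < 1 - \<beta>" "0 < 1 + \<beta>" "0 < \<beta>" using assms(4,5) by auto
  have rm: "2 / (1 - \<beta>) * m1 \<le> real r" using assms(8) r by linarith
  then have m1r: "2 * m1 \<le> (1 - \<beta>) * real r" using b1 by (simp add: field_simps)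
  have r0: "0 < r" using rm b1 \<open>m1 > 0\<close> by (metis divide_pos_pos gr0I less_le_not_le mult_pos_pos of_nat_0 zero_less_numeral)
  \<comment> \<open>Equivalent to \<open>\<beta> \<ge> 1/2\<close>.\<close>
  have "3 * \<alpha> \<le> \<beta>" using b1 assms(4) by (simp add: \<alpha>_def field_simps)
  then have "(1 - \<beta>) * real r \<le> (1 - 3 * \<alpha>) * real r" by (intro mult_right_mono) auto
  then have m1: "2 * m1 \<le> (1 - 3 * \<alpha>) * real r" using m1r by linarith
  have a: "\<alpha> * (1 - \<alpha>) = \<beta> * (2 + \<beta>) / (4 * (1 + \<beta>)^2)"
    using b1 by (simp add: \<alpha>_def field_simps power2_eq_square)
  have m2: "m2 \<le> \<alpha> * (1 - \<alpha>) * real r"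
  proof -
    have "m2 * (4 * (1 + \<beta>)^2) * (1 - \<beta>) = \<beta> * (2 + \<beta>) * (2 * m1)" using assms(6) by (simp add: algebra_simps)
    also have "\<dots> \<le> \<beta> * (2 + \<beta>) * ((1 - \<beta>) * real r)" using m1r b1 by (intro mult_left_mono) auto
    finally have "(m2 * (4 * (1 + \<beta>)^2)) * (1 - \<beta>) \<le> (\<beta> * (2 + \<beta>) * real r) * (1 - \<beta>)" by (simp add: mult_ac)
    then have "m2 * (4 * (1 + \<beta>)^2) \<le> \<beta> * (2 + \<beta>) * real r" using b1 by simp
    then show ?thesis unfolding a using b1 by (simp add: pos_le_divide_eq)
  qed
  note gc = assms(7)
  have "sparse_coloring V (\<lambda>u v. {u, v} \<in> E) r m1 m2 \<alpha>"
  proof unfold_locales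
    show "card {u\<in>V. {v, u} \<in> E} \<le> r" if "v \<in> V" for v
      using card_neighbours_le_max_degree[OF gc that] r by linarith
    show "\<alpha> \<le> 1/4" using b1 by (simp add: \<alpha>_def field_simps)
    show "0 \<le> \<alpha>" using b1 by (simp add: \<alpha>_def)
  qed (use finite_vertices[OF gc] not_loop[OF gc] exists_low_degree[OF gc] cut_bound[OF gc] m1 m2
      in \<open>auto simp: insert_commute\<close>)
  then show "equitable_coloring V E r"
    by (intro equitable_coloring_if_has_equitable[OF gc] sparse_equitable[OF _ r0])
qed

end
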